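(* Let $t$ be a non-negative integer and $\ell$ a positive integer, let $H$ be a $t$-tree, let $P$ be a path, let $K_\ell$ be a complete graph on $\ell$ vertices, and let $G$ be a subgraph of the strong product $H\boxtimes P\boxtimes K_\ell$. Then $G$ has an odd colouring using at most $8\ell t+5\ell-1$ colours.
   Context: All graphs are finite and simple. A $t$-tree is a graph that is either a clique on $t+1$ vertices, or a graph $H$ containing a vertex $v$ of degree $t$ whose neighbours form a clique and such that $H-\{v\}$ is a $t$-tree. For graphs $A$ and $B$, the strong product $A\boxtimes B$ has vertex set $V(A)\times V(B)$, and $(x_1,y_1)(x_2,y_2)$ is an edge iff (i) $x_1x_2\in E(A)$ and $y_1=y_2$, or (ii) $x_1=x_2$ and $y_1y_2\in E(B)$, or (iii) $x_1x_2\in E(A)$ and $y_1y_2\in E(B)$; the triple product is $(H\boxtimes P)\boxtimes K_\ell$. A vertex colouring $\varphi:V(G)\to\mathbb{N}$ (not necessarily proper) is odd if for every vertex $v$ with $|N_G(v)|>0$ there is a colour $\alpha$ such that $|\{w\in N_G(v):\varphi(w)=\alpha\}|$ is odd. A colouring uses $c$ colours if $|\{\varphi(v):v\in V(G)\}|=c$. *)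

theory Defs
  imports "Graph_Theory.Graph_Theory"
begin

text \<open>
  A finite simple graph is a \<^locale>\<open>pair_graph\<close>: a finite symmetric loop-free digraph, in which an
  edge \<open>uv\<close> is represented by the two arcs \<open>(u, v)\<close> and \<open>(v, u)\<close>.
\<close>

definition neighbours :: "'a pair_pre_digraph \<Rightarrow> 'a \<Rightarrow> 'a set" where
  "neighbours G v = {w. (v, w) \<in> parcs G}"

definition clique_in :: "'a pair_pre_digraph \<Rightarrow> 'a set \<Rightarrow> bool" where
  "clique_in G S \<longleftrightarrow> S \<subseteq> pverts G \<and> (\<forall>x\<in>S. \<forall>y\<in>S. x \<noteq> y \<longrightarrow> (x, y) \<in> parcs G)"

definition remove_vertex :: "'a pair_pre_digraph \<Rightarrow> 'a \<Rightarrow> 'a pair_pre_digraph" where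
  "remove_vertex G v =
     \<lparr>pverts = pverts G - {v}, parcs = {(x, y) \<in> parcs G. x \<noteq> v \<and> y \<noteq> v}\<rparr>"

lemma with_proj_remove_vertex:
  "with_proj (remove_vertex G v) = pre_digraph.del_vert (with_proj G) v"
  by (auto simp: remove_vertex_def with_proj_def pre_digraph.del_vert_def)

inductive t_tree :: "nat \<Rightarrow> 'a pair_pre_digraph \<Rightarrow> bool" for t :: nat where
  clique: "complete_digraph (t + 1) (with_proj H) \<Longrightarrow> t_tree t H"
| add_vertex: "pair_graph H \<Longrightarrow> v \<in> pverts H \<Longrightarrow> card (neighbours H v) = t \<Longrightarrow>
    clique_in H (neighbours H v) \<Longrightarrow> t_tree t (remove_vertex H v) \<Longrightarrow> t_tree t H"

definition path_graph :: "'a pair_pre_digraph \<Rightarrow> bool" where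
  "path_graph P \<longleftrightarrow> (\<exists>xs. xs \<noteq> [] \<and> distinct xs \<and> pverts P = set xs \<and>
     parcs P = (\<Union>i\<in>{i. Suc i < length xs}. {(xs ! i, xs ! Suc i), (xs ! Suc i, xs ! i)}))"

definition strong_product ::
    "'a pair_pre_digraph \<Rightarrow> 'b pair_pre_digraph \<Rightarrow> ('a \<times> 'b) pair_pre_digraph" (infixl \<open>\<boxtimes>\<close> 70) where
  "A \<boxtimes> B = \<lparr>pverts = pverts A \<times> pverts B,
     parcs = {((x1, y1), (x2, y2)). {x1, x2} \<subseteq> pverts A \<and> {y1, y2} \<subseteq> pverts B \<and>
       ((x1, x2) \<in> parcs A \<and> y1 = y2 \<or>
        x1 = x2 \<and> (y1, y2) \<in> parcs B \<or>
        (x1, x2) \<in> parcs A \<and> (y1, y2) \<in> parcs B)}\<rparr>"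

definition odd_colouring :: "'a pair_pre_digraph \<Rightarrow> ('a \<Rightarrow> nat) \<Rightarrow> bool" where
  "odd_colouring G \<phi> \<longleftrightarrow> (\<forall>v\<in>pverts G. card (neighbours G v) > 0 \<longrightarrow>
     (\<exists>\<alpha>. odd (card {w \<in> neighbours G v. \<phi> w = \<alpha>})))"

definition num_colours :: "'a pair_pre_digraph \<Rightarrow> ('a \<Rightarrow> nat) \<Rightarrow> nat" where
  "num_colours G \<phi> = card (\<phi> ` pverts G)"

lemma pair_graph_t_tree: "t_tree t H \<Longrightarrow> pair_graph H"
  by (induction rule: t_tree.induct) (auto intro: pair_graphI_complete)

lemma pair_graph_path_graph:
  assumes "path_graph P"
  shows "pair_graph P"
proof -
  obtain xs where xs: "distinct xs" "pverts P = set xs"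
    "parcs P = (\<Union>i\<in>{i. Suc i < length xs}. {(xs ! i, xs ! Suc i), (xs ! Suc i, xs ! i)})"
    using assms by (auto simp: path_graph_def)
  have "finite {i. Suc i < length xs}"
    by (rule finite_subset[of _ "{..<length xs}"]) auto
  then have "finite (parcs P)"
    by (simp add: xs)
  with xs show ?thesis
    by unfold_locales (auto simp: symmetric_def sym_def nth_eq_iff_index_eq)
qed

lemma pair_graph_strong_product:
  assumes "pair_graph A" and "pair_graph B"
  shows "pair_graph (A \<boxtimes> B)"
proof -
  interpret A: pair_graph A by fact
  interpret B: pair_graph B by fact
  have "parcs (A \<boxtimes> B) \<subseteq> (pverts A \<times> pverts B) \<times> (pverts A \<times> pverts B)"
    by (auto simp: strong_product_def)
  then have "finite (parcs (A \<boxtimes> B))"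
    by (rule finite_subset) (simp add: A.pair_finite_verts B.pair_finite_verts)
  then show ?thesis
    by unfold_locales
      (auto simp: strong_product_def symmetric_def sym_def
        A.pair_finite_verts B.pair_finite_verts
        dest: A.arcs_symmetric B.arcs_symmetric A.no_loops' B.no_loops')
qed

end

theory Submission
  imports Defs "HOL-Library.Product_Lexorder"
begin

text \<open>
  Order the vertices of \<open>G\<close>. If every vertex \<open>u\<close> avoids the colours of those \<open>v < u\<close> that are the
  first neighbour of some neighbour of \<open>u\<close>, then the colour of the first neighbour of \<open>w\<close> occurs
  exactly once around \<open>w\<close>. A greedy colouring achieves this: \<open>u\<close> has to avoid one colour for each
  neighbour \<open>w < u\<close>, and the colours of those \<open>v < u\<close> that share a neighbour \<open>w > u\<close> with \<open>u\<close>.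

  A subgraph of \<open>H \<boxtimes> P \<boxtimes> K\<close> is viewed as a graph whose vertices are sorted into cells of at most
  \<open>l\<close> vertices by a vertex of \<open>H\<close> and a layer, the position in \<open>P\<close>. Order it lexicographically, with
  \<open>H\<close> in the order in which the \<open>t\<close>-tree is built. Both kinds of vertices to avoid then lie over
  the vertex of \<open>u\<close> in \<open>H\<close> or over one of its \<open>t\<close> earlier neighbours, because earlier neighbours form
  a clique. Their layer differs from that of \<open>u\<close> by at most \<open>k = 1\<close> for the first kind and \<open>k = 2\<close>
  for the second, and it is not above that of \<open>u\<close> over the same vertex of \<open>H\<close>. This leaves fewer
  than \<open>(2k + 1)lt + (k + 1)l\<close> vertices of each kind.
\<close>

section \<open>Odd colourings from vertex orderings\<close>

lemma greedy_colouring: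
  fixes r :: "'v \<Rightarrow> 'o::linorder" and F :: "'v \<Rightarrow> 'v set"
  assumes "finite V"
    and "\<And>u. u \<in> V \<Longrightarrow> F u \<subseteq> {v \<in> V. r v < r u}"
    and "\<And>u. u \<in> V \<Longrightarrow> card (F u) < n"
  shows "\<exists>\<phi>. \<phi> ` V \<subseteq> {..<n} \<and> (\<forall>u\<in>V. \<forall>v\<in>F u. \<phi> u \<noteq> \<phi> v)"
  using assms
proof (induction V rule: finite_ranking_induct[where f = r])
  case empty
  then show ?case by simp
next
  case (insert u S)
  have F_subset: "F x \<subseteq> {v \<in> S. r v < r x}" and u_notin: "u \<notin> F x" if "x \<in> insert u S" for x
    using insert.prems(1)[OF that] insert.hyps(2) that by fastforce+
  then obtain \<phi> where range: "\<phi> ` S \<subseteq> {..<n}" and avoids: "\<forall>x\<in>S. \<forall>v\<in>F x. \<phi> x \<noteq> \<phi> v"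
    using insert.IH insert.prems(2) by auto
  have finite_F: "finite (F u)"
    using F_subset[of u] insert.hyps(1) by (auto intro: finite_subset)
  have "card (\<phi> ` F u) < card {..<n}"
    using insert.prems(2)[of u] card_image_le[OF finite_F, of \<phi>] by simp
  then obtain \<alpha> where \<alpha>: "\<alpha> < n" "\<alpha> \<notin> \<phi> ` F u"
    using card_mono[of "\<phi> ` F u" "{..<n}"] finite_F by force
  show ?case
    using range avoids \<alpha> u_notin by (intro exI[of _ "\<phi>(u := \<alpha>)"]) auto
qed

context pair_graph
begin

lemma neighbours_subset_pverts: "neighbours G v \<subseteq> pverts G"
  by (auto simp: neighbours_def dest: in_arcsD2)

lemma finite_neighbours: "finite (neighbours G v)"
  using neighbours_subset_pverts pair_finite_verts by (rule finite_subset)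

lemma neighbours_commute: "w \<in> neighbours G v \<longleftrightarrow> v \<in> neighbours G w"
  by (auto simp: neighbours_def dest: arcs_symmetric)

lemma notin_neighbours_self: "v \<notin> neighbours G v"
  by (auto simp: neighbours_def dest: no_loops')

end

definition left_neighbours :: "('v \<Rightarrow> 'o::linorder) \<Rightarrow> 'v pair_pre_digraph \<Rightarrow> 'v \<Rightarrow> 'v set" where
  "left_neighbours r G u = {w \<in> neighbours G u. r w < r u}"

definition left_siblings :: "('v \<Rightarrow> 'o::linorder) \<Rightarrow> 'v pair_pre_digraph \<Rightarrow> 'v \<Rightarrow> 'v set" where
  "left_siblings r G u =
     {v. r v < r u \<and> (\<exists>w. u \<in> left_neighbours r G w \<and> v \<in> left_neighbours r G w)}"

definition first_neighbour :: "('v \<Rightarrow> 'o::linorder) \<Rightarrow> 'v pair_pre_digraph \<Rightarrow> 'v \<Rightarrow> 'v" where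
  "first_neighbour r G w = arg_min_on r (neighbours G w)"

definition conflicts :: "('v \<Rightarrow> 'o::linorder) \<Rightarrow> 'v pair_pre_digraph \<Rightarrow> 'v \<Rightarrow> 'v set" where
  "conflicts r G u = {v \<in> first_neighbour r G ` neighbours G u. r v < r u}"

locale ordered_pair_graph = pair_graph G for G :: "'v pair_pre_digraph" +
  fixes r :: "'v \<Rightarrow> 'o::linorder"
  assumes inj_on_order: "inj_on r (pverts G)"
begin

lemma finite_left_neighbours: "finite (left_neighbours r G u)"
  by (simp add: left_neighbours_def finite_neighbours)

lemma left_siblings_subset_pverts: "left_siblings r G u \<subseteq> pverts G"
  using neighbours_subset_pverts by (auto simp: left_siblings_def left_neighbours_def)

lemma first_neighbour_in_neighbours:
  "neighbours G w \<noteq> {} \<Longrightarrow> first_neighbour r G w \<in> neighbours G w"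
  unfolding first_neighbour_def by (rule arg_min_if_finite(1)[OF finite_neighbours])

lemma first_neighbour_less:
  assumes "v \<in> neighbours G w" and "v \<noteq> first_neighbour r G w"
  shows "r (first_neighbour r G w) < r v"
proof -
  have nonempty: "neighbours G w \<noteq> {}"
    using assms(1) by auto
  have "\<not> r v < r (first_neighbour r G w)"
    unfolding first_neighbour_def
    using arg_min_if_finite(2)[OF finite_neighbours nonempty] assms(1) by blast
  moreover have "v \<in> pverts G" "first_neighbour r G w \<in> pverts G"
    using assms(1) first_neighbour_in_neighbours[OF nonempty] neighbours_subset_pverts[of w] by auto
  then have "r v \<noteq> r (first_neighbour r G w)"
    using assms(2) inj_on_order by (simp add: inj_on_eq_iff)
  ultimately show ?thesis by order
qed

lemma conflicts_subset_pverts: "conflicts r G u \<subseteq> pverts G"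
proof -
  have "first_neighbour r G w \<in> pverts G" if "w \<in> neighbours G u" for w
  proof -
    have "neighbours G w \<noteq> {}"
      using that neighbours_commute by blast
    then show ?thesis
      using first_neighbour_in_neighbours neighbours_subset_pverts by blast
  qed
  then show ?thesis
    by (auto simp: conflicts_def)
qed

lemma conflicts_subset:
  assumes "u \<in> pverts G"
  shows "conflicts r G u \<subseteq>
    first_neighbour r G ` left_neighbours r G u \<union> left_siblings r G u"
proof
  fix v assume "v \<in> conflicts r G u"
  then obtain w where v: "v = first_neighbour r G w" "r v < r u" and w: "w \<in> neighbours G u"
    by (auto simp: conflicts_def)
  have u: "u \<in> neighbours G w"
    using w neighbours_commute by simp
  then have "v \<in> neighbours G w"
    using v(1) first_neighbour_in_neighbours by auto
  moreover have "w \<in> pverts G" "w \<noteq> u"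
    using w neighbours_subset_pverts notin_neighbours_self by auto
  then have "r w \<noteq> r u"
    using assms inj_on_order by (simp add: inj_on_eq_iff)
  ultimately show "v \<in> first_neighbour r G ` left_neighbours r G u \<union> left_siblings r G u"
    using u v w by (cases "r w < r u") (auto simp: left_neighbours_def left_siblings_def)
qed

lemma card_conflicts_le:
  assumes "u \<in> pverts G"
  shows "card (conflicts r G u) \<le> card (left_neighbours r G u) + card (left_siblings r G u)"
proof -
  have "finite (left_siblings r G u)"
    using left_siblings_subset_pverts pair_finite_verts by (rule finite_subset)
  then have "card (conflicts r G u) \<le>
      card (first_neighbour r G ` left_neighbours r G u \<union> left_siblings r G u)"
    using conflicts_subset[OF assms] by (intro card_mono) (auto simp: finite_left_neighbours)
  also have "\<dots> \<le> card (first_neighbour r G ` left_neighbours r G u) + card (left_siblings r G u)"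
    by (rule card_Un_le)
  also have "\<dots> \<le> card (left_neighbours r G u) + card (left_siblings r G u)"
    by (simp add: card_image_le finite_left_neighbours)
  finally show ?thesis .
qed

lemma odd_colouring_if_avoids_conflicts:
  assumes "\<And>u v. u \<in> pverts G \<Longrightarrow> v \<in> conflicts r G u \<Longrightarrow> \<phi> u \<noteq> \<phi> v"
  shows "odd_colouring G \<phi>"
  unfolding odd_colouring_def
proof (intro ballI impI)
  fix w assume "card (neighbours G w) > 0"
  let ?m = "first_neighbour r G w"
  have "?m \<in> neighbours G w"
    using \<open>card (neighbours G w) > 0\<close> by (auto intro: first_neighbour_in_neighbours)
  moreover have "v = ?m" if v: "v \<in> neighbours G w" "\<phi> v = \<phi> ?m" for v
  proof (rule ccontr)
    assume "v \<noteq> ?m"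
    then have "?m \<in> conflicts r G v"
      using v(1) first_neighbour_less neighbours_commute by (auto simp: conflicts_def)
    then show False
      using assms v neighbours_subset_pverts by blast
  qed
  ultimately have "{v \<in> neighbours G w. \<phi> v = \<phi> ?m} = {?m}"
    by auto
  then show "\<exists>\<alpha>. odd (card {v \<in> neighbours G w. \<phi> v = \<alpha>})"
    by (intro exI[of _ "\<phi> ?m"]) simp
qed

theorem ex_odd_colouring:
  assumes "\<And>u. u \<in> pverts G \<Longrightarrow> card (left_neighbours r G u) + card (left_siblings r G u) < n"
  shows "\<exists>\<phi>. odd_colouring G \<phi> \<and> num_colours G \<phi> \<le> n"
proof -
  have "conflicts r G u \<subseteq> {v \<in> pverts G. r v < r u}" if "u \<in> pverts G" for u
    using conflicts_subset_pverts by (auto simp: conflicts_def)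
  moreover have "card (conflicts r G u) < n" if "u \<in> pverts G" for u
    using card_conflicts_le[OF that] assms[OF that] by simp
  ultimately have "\<exists>\<phi>. \<phi> ` pverts G \<subseteq> {..<n} \<and>
      (\<forall>u\<in>pverts G. \<forall>v\<in>conflicts r G u. \<phi> u \<noteq> \<phi> v)"
    by (rule greedy_colouring[OF pair_finite_verts])
  then obtain \<phi> where range: "\<phi> ` pverts G \<subseteq> {..<n}"
    and avoids: "\<forall>u\<in>pverts G. \<forall>v\<in>conflicts r G u. \<phi> u \<noteq> \<phi> v"
    by blast
  have "odd_colouring G \<phi>"
    using avoids by (intro odd_colouring_if_avoids_conflicts) blast
  moreover have "num_colours G \<phi> \<le> n"
    unfolding num_colours_def using card_mono[OF _ range] by simp
  ultimately show ?thesis by blast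
qed

end

section \<open>Elimination orderings of \<open>t\<close>-trees\<close>

definition elimination_ordering ::
    "nat \<Rightarrow> 'a pair_pre_digraph \<Rightarrow> ('a \<Rightarrow> 'o::linorder) \<Rightarrow> bool" where
  "elimination_ordering t H f \<longleftrightarrow> inj_on f (pverts H) \<and>
     (\<forall>x\<in>pverts H. card (left_neighbours f H x) \<le> t \<and> clique_in H (left_neighbours f H x))"

lemma elimination_ordering_closed_left_neighbours:
  assumes "elimination_ordering t H f" and "z \<in> pverts H"
    and "x \<in> insert z (left_neighbours f H z)" and "y \<in> insert z (left_neighbours f H z)"
    and "f x \<le> f y"
  shows "x \<in> insert y (left_neighbours f H y)"
proof -
  consider "x = y" | "y = z" | "x \<noteq> y" "x \<in> left_neighbours f H z" "y \<in> left_neighbours f H z"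
    using assms(3-5) by (auto simp: left_neighbours_def)
  then show ?thesis
  proof cases
    case 3
    then have "x \<in> pverts H" "y \<in> pverts H" "x \<in> neighbours H y"
      using assms(1,2) by (auto simp: elimination_ordering_def clique_in_def neighbours_def)
    moreover from this have "f x \<noteq> f y"
      using assms(1) 3(1) by (auto simp: elimination_ordering_def dest: inj_onD)
    then have "f x < f y"
      using assms(5) by order
    ultimately show ?thesis
      by (simp add: left_neighbours_def)
  qed (use assms(3) in auto)
qed

lemma elimination_ordering_complete:
  assumes "complete_digraph (t + 1) (with_proj H)" and "inj_on f (pverts H)"
  shows "elimination_ordering t H f"
proof -
  interpret pair_graph H
    using assms(1) by (rule pair_graphI_complete)
  have card: "card (pverts H) = t + 1"
    and arcs: "parcs H = {(u, v). u \<in> pverts H \<and> v \<in> pverts H \<and> u \<noteq> v}"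
    using assms(1) by (auto simp: complete_digraph_pair_def)
  have "card (left_neighbours f H x) \<le> t" if "x \<in> pverts H" for x
  proof -
    have "card (left_neighbours f H x) \<le> card (pverts H - {x})"
      by (rule card_mono) (auto simp: left_neighbours_def neighbours_def arcs)
    then show ?thesis
      using card that by simp
  qed
  moreover have "clique_in H (left_neighbours f H x)" for x
    by (auto simp: clique_in_def left_neighbours_def neighbours_def arcs)
  ultimately show ?thesis
    using assms(2) by (simp add: elimination_ordering_def)
qed

lemma elimination_ordering_add_simplicial:
  assumes "pair_graph H"
    and simplicial: "card (neighbours H v) \<le> t" "clique_in H (neighbours H v)"
    and ordering: "elimination_ordering t (remove_vertex H v) f"
    and last: "\<And>x. x \<in> pverts (remove_vertex H v) \<Longrightarrow> f x < c"
  shows "elimination_ordering t H (f(v := c))"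
proof -
  interpret pair_graph H by fact
  let ?g = "f(v := c)"
  have less: "?g x < ?g v" if "x \<in> pverts H" "x \<noteq> v" for x
    using last that by (simp add: remove_vertex_def)
  have inj: "inj_on f (pverts (remove_vertex H v))"
    using ordering by (simp add: elimination_ordering_def)
  have "inj_on ?g (pverts H)"
  proof (rule inj_onI)
    fix x y assume "x \<in> pverts H" "y \<in> pverts H" "?g x = ?g y"
    then show "x = y"
      using less[of x] less[of y] inj_onD[OF inj, of x y]
      by (cases "x = v"; cases "y = v") (auto simp: remove_vertex_def)
  qed
  moreover have "card (left_neighbours ?g H x) \<le> t \<and> clique_in H (left_neighbours ?g H x)"
    if x: "x \<in> pverts H" for x
  proof (cases "x = v")
    case True
    have "left_neighbours ?g H v = neighbours H v"
      using less neighbours_subset_pverts[of v] notin_neighbours_self[of v]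
      by (auto simp: left_neighbours_def)
    then show ?thesis
      using True simplicial by simp
  next
    case False
    have "left_neighbours ?g H x = left_neighbours f (remove_vertex H v) x"
      using False less[OF x]
      by (auto simp: left_neighbours_def neighbours_def remove_vertex_def split: if_splits)
    moreover have "x \<in> pverts (remove_vertex H v)"
      using x False by (simp add: remove_vertex_def)
    moreover have "clique_in (remove_vertex H v) S \<Longrightarrow> clique_in H S" for S
      by (auto simp: clique_in_def remove_vertex_def)
    ultimately show ?thesis
      using ordering by (simp add: elimination_ordering_def)
  qed
  ultimately show ?thesis
    by (simp add: elimination_ordering_def)
qed

lemma t_tree_elimination_ordering:
  assumes "t_tree t H"
  shows "\<exists>f :: 'a \<Rightarrow> nat. elimination_ordering t H f"
  using assms
proof (induction rule: t_tree.induct)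
  case (clique H)
  interpret H: pair_graph H
    using clique by (rule pair_graphI_complete)
  obtain f :: "'a \<Rightarrow> nat" where "inj_on f (pverts H)"
    using finite_imp_inj_to_nat_seg[OF H.pair_finite_verts] by blast
  then show ?case
    using elimination_ordering_complete[OF clique] by blast
next
  case (add_vertex H v)
  interpret H: pair_graph H by fact
  obtain f :: "'a \<Rightarrow> nat" where f: "elimination_ordering t (remove_vertex H v) f"
    using add_vertex.IH by blast
  have "f x < Suc (Max (f ` pverts H))" if "x \<in> pverts (remove_vertex H v)" for x
    using that by (simp add: remove_vertex_def le_imp_less_Suc)
  then show ?case
    using elimination_ordering_add_simplicial[OF add_vertex.hyps(1) _ _ f] add_vertex.hyps
    by blast
qed

section \<open>Layered partitions\<close>

locale layered_partition = G: pair_graph G + H: pair_graph H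
  for G :: "'v pair_pre_digraph" and H :: "'a pair_pre_digraph" +
  fixes part :: "'v \<Rightarrow> 'a" and layer :: "'v \<Rightarrow> nat" and l :: nat
  assumes part_in_pverts: "v \<in> pverts G \<Longrightarrow> part v \<in> pverts H"
    and part_arc: "(u, v) \<in> parcs G \<Longrightarrow> part u = part v \<or> (part u, part v) \<in> parcs H"
    and layer_arc: "(u, v) \<in> parcs G \<Longrightarrow> layer v \<le> layer u + 1"
    and card_cell_le: "card {v \<in> pverts G. part v = x \<and> layer v = i} \<le> l"
begin

lemma card_cells_le:
  assumes "finite X" and "finite I"
  shows "card {v \<in> pverts G. part v \<in> X \<and> layer v \<in> I} \<le> card X * card I * l"
proof -
  have "{v \<in> pverts G. part v \<in> X \<and> layer v \<in> I} =
      (\<Union>(x, i)\<in>X \<times> I. {v \<in> pverts G. part v = x \<and> layer v = i})"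
    by auto
  also have "card \<dots> \<le> (\<Sum>(x, i)\<in>X \<times> I. card {v \<in> pverts G. part v = x \<and> layer v = i})"
    using card_UN_le[of "X \<times> I" "\<lambda>(x, i). {v \<in> pverts G. part v = x \<and> layer v = i}"] assms
    by (simp add: case_prod_beta)
  also have "\<dots> \<le> card (X \<times> I) * l"
    using sum_bounded_above[of "X \<times> I" "\<lambda>(x, i). card {v \<in> pverts G. part v = x \<and> layer v = i}" l]
      card_cell_le by auto
  finally show ?thesis
    by (simp add: card_cartesian_product)
qed

end

locale ordered_layered_partition = layered_partition G H part layer l
  for G :: "'v pair_pre_digraph" and H :: "'a pair_pre_digraph" and part layer l +
  fixes t :: nat and f :: "'a \<Rightarrow> 'o::linorder" and e :: "'v \<Rightarrow> 'p::linorder"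
  assumes elimination: "elimination_ordering t H f"
    and inj_on_tie_break: "inj_on e (pverts G)"
begin

definition rank :: "'v \<Rightarrow> 'o \<times> nat \<times> 'p" where
  "rank v = (f (part v), layer v, e v)"

sublocale ordered_pair_graph G rank
  using inj_on_tie_break by unfold_locales (auto simp: rank_def inj_on_def)

definition near_predecessors :: "nat \<Rightarrow> 'v \<Rightarrow> 'v set" where
  "near_predecessors k u = {v \<in> pverts G. rank v < rank u \<and>
     part v \<in> insert (part u) (left_neighbours f H (part u)) \<and>
     layer v \<in> {layer u - k..layer u + k}}"

lemma finite_near_predecessors: "finite (near_predecessors k u)"
  by (simp add: near_predecessors_def)

lemma card_near_predecessors_less:
  assumes "u \<in> pverts G"
  shows "card (near_predecessors k u) < (2 * k + 1) * l * t + (k + 1) * l"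
proof -
  let ?L = "left_neighbours f H (part u)"
  let ?left = "{v \<in> pverts G. part v \<in> ?L \<and> layer v \<in> {layer u - k..layer u + k}}"
  let ?same = "{v \<in> pverts G. part v \<in> {part u} \<and> layer v \<in> {layer u - k..layer u}}"
  have "insert u (near_predecessors k u) \<subseteq> ?left \<union> ?same"
    using assms by (auto simp: near_predecessors_def rank_def)
  moreover have "u \<notin> near_predecessors k u"
    by (simp add: near_predecessors_def)
  ultimately have "card (near_predecessors k u) < card (?left \<union> ?same)"
    using card_mono[of "?left \<union> ?same" "insert u (near_predecessors k u)"]
    by (simp add: finite_near_predecessors)
  also have "\<dots> \<le> card ?left + card ?same"
    by (rule card_Un_le)
  also have "card ?left \<le> card ?L * card {layer u - k..layer u + k} * l"
    by (rule card_cells_le) (auto simp: left_neighbours_def H.finite_neighbours)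
  also have "\<dots> \<le> t * (2 * k + 1) * l"
    using elimination part_in_pverts[OF assms]
    by (intro mult_le_mono) (auto simp: elimination_ordering_def)
  also have "card ?same \<le> card {part u} * card {layer u - k..layer u} * l"
    by (rule card_cells_le) auto
  also have "\<dots> \<le> (k + 1) * l"
    by (intro mult_le_mono) auto
  finally show ?thesis
    by (simp add: algebra_simps)
qed

lemma part_left_neighbour:
  assumes "v \<in> left_neighbours rank G u"
  shows "part v \<in> insert (part u) (left_neighbours f H (part u))"
proof -
  have arc: "(u, v) \<in> parcs G" and le: "f (part v) \<le> f (part u)"
    using assms by (auto simp: left_neighbours_def neighbours_def rank_def)
  have "part u \<in> pverts H" "part v \<in> pverts H"
    using arc by (auto intro: part_in_pverts dest: G.in_arcsD1 G.in_arcsD2)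
  then have "part v = part u \<or> f (part v) < f (part u)"
    using le elimination by (auto simp: elimination_ordering_def le_less dest: inj_onD)
  then show ?thesis
    using part_arc[OF arc] by (auto simp: left_neighbours_def neighbours_def)
qed

lemma layer_neighbour:
  assumes "v \<in> neighbours G u"
  shows "layer v \<le> layer u + 1" and "layer u \<le> layer v + 1"
  using assms layer_arc[of u v] layer_arc[of v u] G.arcs_symmetric[of u v]
  by (simp_all add: neighbours_def)

lemma left_neighbours_subset_near_predecessors: "left_neighbours rank G u \<subseteq> near_predecessors 1 u"
proof
  fix v assume left: "v \<in> left_neighbours rank G u"
  then have "v \<in> neighbours G u" "rank v < rank u"
    by (auto simp: left_neighbours_def)
  then show "v \<in> near_predecessors 1 u"
    using part_left_neighbour[OF left] layer_neighbour[of v u] G.neighbours_subset_pverts[of u]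
    by (auto simp: near_predecessors_def)
qed

lemma left_siblings_subset_near_predecessors: "left_siblings rank G u \<subseteq> near_predecessors 2 u"
proof
  fix v assume "v \<in> left_siblings rank G u"
  then obtain w where less: "rank v < rank u"
    and u: "u \<in> left_neighbours rank G w" and v: "v \<in> left_neighbours rank G w"
    by (auto simp: left_siblings_def)
  have nb: "u \<in> neighbours G w" "v \<in> neighbours G w"
    using u v by (auto simp: left_neighbours_def)
  then have in_pverts: "v \<in> pverts G" "part w \<in> pverts H"
    using part_in_pverts by (auto simp: neighbours_def dest: G.in_arcsD1 G.in_arcsD2)
  have "f (part v) \<le> f (part u)"
    using less by (auto simp: rank_def)
  with elimination in_pverts(2) part_left_neighbour[OF v] part_left_neighbour[OF u]
  have "part v \<in> insert (part u) (left_neighbours f H (part u))"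
    by (rule elimination_ordering_closed_left_neighbours)
  moreover have "layer v \<in> {layer u - 2..layer u + 2}"
    using layer_neighbour[OF nb(1)] layer_neighbour[OF nb(2)] by auto
  ultimately show "v \<in> near_predecessors 2 u"
    using in_pverts(1) less by (simp add: near_predecessors_def)
qed

lemma card_left_neighbours_left_siblings_less:
  assumes "u \<in> pverts G"
  shows "card (left_neighbours rank G u) + card (left_siblings rank G u) < 8 * l * t + 5 * l - 1"
proof -
  have "card (left_neighbours rank G u) \<le> card (near_predecessors 1 u)"
    using finite_near_predecessors left_neighbours_subset_near_predecessors by (rule card_mono)
  moreover have "card (left_siblings rank G u) \<le> card (near_predecessors 2 u)"
    using finite_near_predecessors left_siblings_subset_near_predecessors by (rule card_mono)
  ultimately show ?thesis
    using card_near_predecessors_less[OF assms, of 1] card_near_predecessors_less[OF assms, of 2]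
    by simp
qed

end

theorem (in layered_partition) ex_odd_colouring_layered:
  assumes "elimination_ordering t H f"
  shows "\<exists>\<phi>. odd_colouring G \<phi> \<and> num_colours G \<phi> \<le> 8 * l * t + 5 * l - 1"
proof -
  obtain e :: "'v \<Rightarrow> nat" where "inj_on e (pverts G)"
    using finite_imp_inj_to_nat_seg[OF G.pair_finite_verts] by blast
  with assms interpret ordered_layered_partition G H part layer l t f e
    by unfold_locales
  show ?thesis
    using card_left_neighbours_left_siblings_less by (rule ex_odd_colouring)
qed

section \<open>Subgraphs of strong products with a path\<close>

lemma path_graph_position:
  assumes "path_graph P"
  shows "\<exists>pos :: 'b \<Rightarrow> nat. inj_on pos (pverts P) \<and>
    (\<forall>(p, q)\<in>parcs P. pos q = pos p + 1 \<or> pos p = pos q + 1)"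
proof -
  obtain xs where xs: "distinct xs" "pverts P = set xs"
    "parcs P = (\<Union>i\<in>{i. Suc i < length xs}. {(xs ! i, xs ! Suc i), (xs ! Suc i, xs ! i)})"
    using assms by (auto simp: path_graph_def)
  define pos where "pos = the_inv_into {..<length xs} ((!) xs)"
  have inj: "inj_on ((!) xs) {..<length xs}"
    using xs(1) by (auto simp: inj_on_nth)
  have pos_nth: "pos (xs ! i) = i" if "i < length xs" for i
    using the_inv_into_f_f[OF inj] that by (simp add: pos_def)
  then have "inj_on pos (set xs)"
    by (auto simp: inj_on_def in_set_conv_nth)
  then show ?thesis
    using pos_nth by (intro exI[of _ pos]) (auto simp: xs)
qed

lemma strong_product_arcD:
  assumes "(u, v) \<in> parcs (A \<boxtimes> B)"
  shows "fst u = fst v \<or> (fst u, fst v) \<in> parcs A" and "snd u = snd v \<or> (snd u, snd v) \<in> parcs B"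
  using assms by (auto simp: strong_product_def)

lemma layered_partition_strong_product:
  fixes pos :: "'b \<Rightarrow> nat"
  assumes "pair_graph G" and "pair_graph H"
    and pos_inj: "inj_on pos (pverts P)"
    and pos_arc: "\<And>p q. (p, q) \<in> parcs P \<Longrightarrow> pos q \<le> pos p + 1"
    and K: "finite (pverts K)" "card (pverts K) \<le> l"
    and sub: "subgraph (with_proj G) (with_proj (H \<boxtimes> P \<boxtimes> K))"
  shows "layered_partition G H (\<lambda>v. fst (fst v)) (\<lambda>v. pos (snd (fst v))) l"
proof -
  have verts: "pverts G \<subseteq> (pverts H \<times> pverts P) \<times> pverts K"
    and arcs: "parcs G \<subseteq> parcs (H \<boxtimes> P \<boxtimes> K)"
    using sub by (auto simp: subgraph_def strong_product_def)
  have part: "fst (fst u) = fst (fst v) \<or> (fst (fst u), fst (fst v)) \<in> parcs H"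
    and layer: "pos (snd (fst v)) \<le> pos (snd (fst u)) + 1" if "(u, v) \<in> parcs G" for u v
  proof -
    have "(u, v) \<in> parcs (H \<boxtimes> P \<boxtimes> K)"
      using that arcs by blast
    then have "fst u = fst v \<or> (fst u, fst v) \<in> parcs (H \<boxtimes> P)"
      by (rule strong_product_arcD(1))
    then have "fst (fst u) = fst (fst v) \<or> (fst (fst u), fst (fst v)) \<in> parcs H"
      and "snd (fst u) = snd (fst v) \<or> (snd (fst u), snd (fst v)) \<in> parcs P"
      using strong_product_arcD[of "fst u" "fst v" H P] by metis+
    then show "fst (fst u) = fst (fst v) \<or> (fst (fst u), fst (fst v)) \<in> parcs H"
      and "pos (snd (fst v)) \<le> pos (snd (fst u)) + 1"
      using pos_arc[of "snd (fst u)" "snd (fst v)"] by auto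
  qed
  have cell: "card {v \<in> pverts G. fst (fst v) = x \<and> pos (snd (fst v)) = i} \<le> l" for x i
  proof -
    let ?C = "{v \<in> pverts G. fst (fst v) = x \<and> pos (snd (fst v)) = i}"
    have "inj_on snd ?C"
      using verts pos_inj by (auto simp: inj_on_def)
    moreover have "snd ` ?C \<subseteq> pverts K"
      using verts by auto
    ultimately show ?thesis
      using card_inj_on_le[OF _ _ K(1)] K(2) by (meson le_trans)
  qed
  interpret G: pair_graph G by fact
  interpret H: pair_graph H by fact
  show ?thesis
    using verts part layer cell by unfold_locales auto
qed

theorem theorem4:
  fixes t l :: nat
    and H :: "'a pair_pre_digraph"
    and P :: "'b pair_pre_digraph"
    and K :: "'c pair_pre_digraph"
    and G :: "(('a \<times> 'b) \<times> 'c) pair_pre_digraph"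
  assumes "l > 0"
    and "t_tree t H"
    and "path_graph P"
    and "complete_digraph l (with_proj K)"
    and "pair_graph G"
    and "subgraph (with_proj G) (with_proj (H \<boxtimes> P \<boxtimes> K))"
  shows "\<exists>\<phi>. odd_colouring G \<phi> \<and> num_colours G \<phi> \<le> 8 * l * t + 5 * l - 1"
proof -
  interpret K: pair_graph K
    using assms(4) by (rule pair_graphI_complete)
  have card_K: "card (pverts K) = l"
    using assms(4) by (auto simp: complete_digraph_pair_def)
  obtain f :: "'a \<Rightarrow> nat" where ordering: "elimination_ordering t H f"
    using t_tree_elimination_ordering[OF assms(2)] by blast
  obtain pos :: "'b \<Rightarrow> nat" where "inj_on pos (pverts P)"
    and "\<And>p q. (p, q) \<in> parcs P \<Longrightarrow> pos q \<le> pos p + 1"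
    using path_graph_position[OF assms(3)] by fastforce
  then interpret layered_partition G H "\<lambda>v. fst (fst v)" "\<lambda>v. pos (snd (fst v))" l
    using assms(2,5,6) card_K
    by (intro layered_partition_strong_product) (auto intro: pair_graph_t_tree)
  show ?thesis
    using ordering by (rule ex_odd_colouring_layered)
qed

end
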